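(* Let $(X,\|\cdot\|)$ be a Banach space, $T>0$, $J=[0,T]$, $0<\alpha<1$. Let $M_1>0$, $M_2>0$, $0<M_3<1$, and assume that $f,g:J\times X\times X\to X$ are continuous functions such that each $h\in\{f,g\}$ satisfies $$\|h(t_1,x_1,y_1)-h(t_2,x_2,y_2)\|\leq M_1|t_1-t_2|+M_2\|x_1-x_2\|+M_3\|y_1-y_2\|$$ for all $t_1,t_2\in J$ and $x_1,x_2,y_1,y_2\in X$, and that $f(0,x,x)=x=g(0,x,x)$ for all $x\in X$. Let $\theta>0$ be sufficiently large that $\frac{M_2}{\theta}+M_3<1$, and suppose there exists $K>0$ such that $$\|f(t,x,y)-g(t,x,y)\|\leq K\,\mathbb{E}_\alpha(\theta t^\alpha),\quad t\in J,\ x,y\in X.$$ For $h\in\{f,g\}$ consider the equation $$x_z(t)=z(0)+\frac{1}{\Gamma(\alpha)}\int_0^t(t-s)^{\alpha-1}z(s)\,ds,\quad t\in J,\qquad(\mathrm{E}_h)$$ where $z$ is a solution of the functional equation $$z(t)=h\left(t,\,z(0)+\frac{1}{\Gamma(\alpha)}\int_0^t(t-s)^{\alpha-1}z(s)\,ds,\,z(t)\right),\quad t\in J.$$ If $\mathcal{S}$ and $\hat{\mathcal{S}}$ are the solution sets of $(\mathrm{E}_f)$ and $(\mathrm{E}_g)$ respectively, then there exist $L^*,R^*>0$ such that $$H_{\|\cdot\|_B}\left(\mathcal{S},\hat{\mathcal{S}}\right)\leq\frac{K\,T^\alpha}{\Gamma(\alpha+1)\left[1-\left(\frac{M_2}{\theta}+M_3\right)\right]},$$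 where $H_{\|\cdot\|_B}$ is the Pompeiu-Hausdorff functional with respect to $\|\cdot\|_B$ on $C_{L^*}(J,B_{R^*})$.
   Context: The Mittag-Leffler function is $\mathbb{E}_\alpha(u)=\sum_{k=0}^{\infty}\frac{u^k}{\Gamma(\alpha k+1)}$, and the Bielecki norm on $C(J,X)$ (continuous functions $J\to X$), for the given $\theta>0$, is $\|x\|_B=\sup_{t\in J}\frac{\|x(t)\|}{\mathbb{E}_\alpha(\theta t^\alpha)}$. For $R>0$, $B_R=\{x\in X:\|x\|\le R\}$. For $L,R>0$, $$C_L(J,B_R)=\{x\in C(J,B_R):\|x(t_1)-x(t_2)\|\le L|t_1-t_2|\ \text{for all } t_1,t_2\in J\},$$ where $C(J,B_R)$ is the set of continuous functions $J\to B_R$. A solution of $(\mathrm{E}_h)$ is a function $x=x_z$ given by the formula $(\mathrm{E}_h)$ for some continuous $z:J\to X$ solving the displayed functional equation with $h$. The solution sets $\mathcal{S},\hat{\mathcal{S}}$ are taken as subsets of $C_{L^*}(J,B_{R^*})$, i.e. they consist of the solutions lying in that space. For a metric space $(E,d)$ and nonempty subsets $Y,Z\subseteq E$, the Pompeiu-Hausdorff functional is $$H_d(Y,Z)=\max\left\{\sup_{a\in Y}\inf_{b\in Z}d(a,b),\ \sup_{b\in Z}\inf_{a\in Y}d(a,b)\right\}\in[0,\infty],$$ and $H_{\|\cdot\|_B}$ is $H_d$ with $d(x,y)=\|x-y\|_B$. *)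

theory Defs
  imports "HOL-Analysis.Analysis"
begin

definition mittag_leffler :: "real \<Rightarrow> real \<Rightarrow> real" where
  "mittag_leffler \<alpha> u = (\<Sum>k. u ^ k / Gamma (\<alpha> * real k + 1))"

text \<open>
  Throughout, \<open>J = {0..T}\<close>, and a function on \<open>J\<close> is an extensional function on the reals,
  so that two functions are equal as soon as they agree on \<open>J\<close>.
\<close>

definition bielecki_norm :: "real \<Rightarrow> real \<Rightarrow> real \<Rightarrow> (real \<Rightarrow> 'a::real_normed_vector) \<Rightarrow> real" where
  "bielecki_norm T \<alpha> \<theta> x = (SUP t\<in>{0..T}. norm (x t) / mittag_leffler \<alpha> (\<theta> * t powr \<alpha>))"

definition cont_funs :: "real \<Rightarrow> 'a::topological_space set \<Rightarrow> (real \<Rightarrow> 'a) set" where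
  "cont_funs T B = {x \<in> {0..T} \<rightarrow>\<^sub>E B. continuous_on {0..T} x}"

definition lip_funs :: "real \<Rightarrow> real \<Rightarrow> 'a::real_normed_vector set \<Rightarrow> (real \<Rightarrow> 'a) set" where
  "lip_funs T L B = {x \<in> cont_funs T B.
     \<forall>t1\<in>{0..T}. \<forall>t2\<in>{0..T}. norm (x t1 - x t2) \<le> L * \<bar>t1 - t2\<bar>}"

text \<open>
  The value \<open>x\<^sub>z(t)\<close>. The integral is the Henstock-Kurzweil integral, which is available in every
  Banach space. At \<open>s = t\<close> the kernel takes the value \<open>0 powr (\<alpha> - 1) = 0\<close>, which does not affect
  the integral.
\<close>

definition frac_primitive :: "real \<Rightarrow> (real \<Rightarrow> 'a::banach) \<Rightarrow> real \<Rightarrow> 'a" where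
  "frac_primitive \<alpha> z t =
     z 0 + (1 / Gamma \<alpha>) *\<^sub>R integral {0..t} (\<lambda>s. (t - s) powr (\<alpha> - 1) *\<^sub>R z s)"

definition solves_functional_eq ::
    "real \<Rightarrow> real \<Rightarrow> (real \<Rightarrow> 'a \<Rightarrow> 'a \<Rightarrow> 'a) \<Rightarrow> (real \<Rightarrow> 'a::banach) \<Rightarrow> bool" where
  "solves_functional_eq T \<alpha> h z \<longleftrightarrow>
     z \<in> cont_funs T UNIV \<and> (\<forall>t\<in>{0..T}. z t = h t (frac_primitive \<alpha> z t) (z t))"

definition solution_set ::
    "real \<Rightarrow> real \<Rightarrow> (real \<Rightarrow> 'a \<Rightarrow> 'a \<Rightarrow> 'a) \<Rightarrow> real \<Rightarrow> real \<Rightarrow> (real \<Rightarrow> 'a::banach) set" where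
  "solution_set T \<alpha> h L R =
     {x \<in> lip_funs T L (cball 0 R).
        \<exists>z. solves_functional_eq T \<alpha> h z \<and> (\<forall>t\<in>{0..T}. x t = frac_primitive \<alpha> z t)}"

text \<open>
  Meaningful for nonempty \<open>Y\<close> and \<open>Z\<close> only: if both are empty, the value is \<open>0\<close>.
\<close>

definition pompeiu_hausdorff :: "('b \<Rightarrow> 'b \<Rightarrow> real) \<Rightarrow> 'b set \<Rightarrow> 'b set \<Rightarrow> ennreal" where
  "pompeiu_hausdorff d Y Z =
     max (SUP a\<in>Y. INF b\<in>Z. ennreal (d a b)) (SUP b\<in>Z. INF a\<in>Y. ennreal (d a b))"

end

theory Submission
  imports Defs
begin

text \<open>
  Write \<open>W t = E\<^sub>\<alpha> (\<theta> t\<^sup>\<alpha>)\<close> for the weight of the Bielecki norm, \<open>I\<close> for the Riemann-Liouville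
  integral of order \<open>\<alpha>\<close>, and \<open>q = M2 / \<theta> + M3 < 1\<close>.

  The Lipschitz requirement determines the initial value. If \<open>x = z 0 + I z\<close>, then
  \<open>x t - x 0 = (t\<^sup>\<alpha> / \<Gamma>(\<alpha> + 1)) z 0 + o(t\<^sup>\<alpha>)\<close> as \<open>t\<close> tends to \<open>0\<close>, and as \<open>\<alpha> < 1\<close> this is
  compatible with a Lipschitz bound only if \<open>z 0 = 0\<close> (\<open>frac_integral_lipschitz_imp_zero\<close>).
  Every member of either solution set is therefore generated by a trajectory starting at \<open>0\<close>,
  and the Hausdorff estimate reduces to two facts: any member of the one set is within the
  stated distance of any member of the other, and both sets are nonempty.

  For the distance, the key inequality is \<open>I W \<le> W / \<theta>\<close> (\<open>frac_integral_weighted_bound\<close>), which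
  holds because \<open>I\<close> shifts the Mittag-Leffler series by one term. It makes \<open>z \<mapsto> h(\<cdot>, I z, z)\<close> a
  \<open>q\<close>-contraction in the weighted norm (\<open>weighted_contraction\<close>), so that solutions for \<open>f\<close> and \<open>g\<close>
  differ by at most \<open>K / (1 - q) * W\<close> (\<open>stability\<close>). One more fractional integration, with \<open>W\<close>
  increasing, gives the bound on \<open>x - y\<close> (\<open>solution_sets_close\<close>).

  For nonemptiness a solution must be found whose fractional integral is Lipschitz. Picard
  iteration from \<open>0\<close> converges by the contraction property. The iterates all satisfy
  \<open>norm (z t - z s) \<le> \<l> (t - s) W t\<close> for \<open>s \<le> t\<close>, with \<open>\<l> = M1 / (1 - q)\<close>: if \<open>z\<close> is extended by \<open>0\<close> to
  negative times, \<open>I z t - I z s\<close> is the fractional integral of \<open>r \<mapsto> z r - z (r - (t - s))\<close> at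
  time \<open>t\<close>, so that the condition is reproduced with the factor \<open>1 / \<theta>\<close>
  (\<open>picard_step_admissible\<close>). The condition is closed under pointwise limits, hence the solution
  satisfies it too (\<open>solution_set_nonempty\<close>).
\<close>

section \<open>The Mittag-Leffler function\<close>

text \<open>
  Wendel's inequality: \<open>x + 1\<close> is the convex combination of \<open>x + \<alpha>\<close> and \<open>x + \<alpha> + 1\<close> with
  weights \<open>\<alpha>\<close> and \<open>1 - \<alpha>\<close>, so log-convexity bounds \<open>\<Gamma>(x + 1) = x \<Gamma>(x)\<close> by
  \<open>\<Gamma>(x + \<alpha>) (x + \<alpha>)\<^sup>1\<^sup>-\<^sup>\<alpha>\<close>. It supplies the decay of the ratio of consecutive
  Mittag-Leffler coefficients.
\<close>

lemma Gamma_ratio_bound: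
  fixes x \<alpha> :: real
  assumes x: "0 < x" and \<alpha>: "0 < \<alpha>" "\<alpha> < 1"
  shows "Gamma x / Gamma (x + \<alpha>) \<le> (x + \<alpha>) powr (1 - \<alpha>) / x"
proof -
  have pos: "0 < Gamma x" "0 < Gamma (x + \<alpha>)" "0 < Gamma (x + \<alpha> + 1)" "0 < Gamma (x + 1)"
    using x \<alpha> by (auto intro!: Gamma_real_pos)
  have g1: "Gamma (x + 1) = x * Gamma x" "Gamma (x + \<alpha> + 1) = (x + \<alpha>) * Gamma (x + \<alpha>)"
    using x \<alpha> by (auto intro!: Gamma_plus1 elim!: nonpos_Ints_cases)
  have "(ln \<circ> Gamma) ((1 - (1 - \<alpha>)) *\<^sub>R (x + \<alpha>) + (1 - \<alpha>) *\<^sub>R (x + \<alpha> + 1))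
      \<le> (1 - (1 - \<alpha>)) * (ln \<circ> Gamma) (x + \<alpha>) + (1 - \<alpha>) * (ln \<circ> Gamma) (x + \<alpha> + 1)"
    by (rule convex_onD[OF log_convex_Gamma_real]) (use x \<alpha> in auto)
  moreover have "(1 - (1 - \<alpha>)) *\<^sub>R (x + \<alpha>) + (1 - \<alpha>) *\<^sub>R (x + \<alpha> + 1) = x + 1"
    by (simp add: algebra_simps)
  ultimately have "ln (Gamma (x + 1)) \<le> \<alpha> * ln (Gamma (x + \<alpha>)) + (1 - \<alpha>) * ln (Gamma (x + \<alpha> + 1))"
    by simp
  also have "ln (Gamma (x + \<alpha> + 1)) = ln (x + \<alpha>) + ln (Gamma (x + \<alpha>))"
    unfolding g1(2) by (rule ln_mult_pos) (use x \<alpha> pos in auto)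
  also have "\<alpha> * ln (Gamma (x + \<alpha>)) + (1 - \<alpha>) * (ln (x + \<alpha>) + ln (Gamma (x + \<alpha>)))
      = ln ((x + \<alpha>) powr (1 - \<alpha>) * Gamma (x + \<alpha>))"
  proof -
    have "ln ((x + \<alpha>) powr (1 - \<alpha>) * Gamma (x + \<alpha>)) = ln ((x + \<alpha>) powr (1 - \<alpha>)) + ln (Gamma (x + \<alpha>))"
      by (rule ln_mult_pos) (use x \<alpha> pos in auto)
    then show ?thesis using x \<alpha> by (simp add: ln_powr algebra_simps)
  qed
  finally have "Gamma (x + 1) \<le> (x + \<alpha>) powr (1 - \<alpha>) * Gamma (x + \<alpha>)"
    using x \<alpha> pos by (subst (asm) ln_le_cancel_iff) auto
  then show ?thesis
    unfolding g1 using x pos by (simp add: field_simps)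
qed

text \<open>
  The ratio test applies: by the preceding bound the quotient of consecutive terms is
  \<open>O(k powr (- \<alpha>))\<close>.
\<close>

lemma summable_mittag_leffler:
  fixes u \<alpha> :: real
  assumes \<alpha>: "0 < \<alpha>" "\<alpha> < 1"
  shows "summable (\<lambda>k. u ^ k / Gamma (\<alpha> * real k + 1))"
proof -
  let ?r = "\<lambda>x::real. (x + \<alpha>) powr (1 - \<alpha>) / x"
  have "((\<lambda>x. (1 + \<alpha>) powr (1 - \<alpha>) * x powr (- \<alpha>)) \<longlongrightarrow> (1 + \<alpha>) powr (1 - \<alpha>) * 0) at_top"
    by (intro tendsto_intros tendsto_neg_powr filterlim_ident) (use \<alpha> in auto)
  then have lim0: "((\<lambda>x. (1 + \<alpha>) powr (1 - \<alpha>) * x powr (- \<alpha>)) \<longlongrightarrow> 0) at_top" by simp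
  have "(?r \<longlongrightarrow> 0) at_top"
  proof (rule tendsto_sandwich[OF _ _ tendsto_const lim0])
    show "\<forall>\<^sub>F x in at_top. 0 \<le> ?r x"
      using eventually_gt_at_top[of 0] by eventually_elim (use \<alpha> in auto)
    show "\<forall>\<^sub>F x in at_top. ?r x \<le> (1 + \<alpha>) powr (1 - \<alpha>) * x powr - \<alpha>"
      using eventually_ge_at_top[of 1]
    proof eventually_elim
      case (elim x)
      have "(x + \<alpha>) powr (1 - \<alpha>) \<le> ((1 + \<alpha>) * x) powr (1 - \<alpha>)"
        by (rule powr_mono2) (use elim \<alpha> in \<open>auto simp: algebra_simps mult_left_le\<close>)
      also have "\<dots> = (1 + \<alpha>) powr (1 - \<alpha>) * (x powr (- \<alpha>) * x)"
        
      proof -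
        have "x powr (1 - \<alpha>) = x powr (- \<alpha>) * x"
          using elim powr_add[of x "- \<alpha>" 1] by simp
        then show ?thesis using elim \<alpha> by (simp add: powr_mult)
      qed
      finally show ?case using elim by (simp add: field_simps)
    qed
  qed
  moreover have "filterlim (\<lambda>k. \<alpha> * real k + 1) at_top sequentially"
    using filterlim_tendsto_add_at_top[OF tendsto_const[of 1]
        filterlim_tendsto_pos_mult_at_top[OF tendsto_const \<alpha>(1) filterlim_real_sequentially]]
    by (simp add: add.commute)
  ultimately have "(\<lambda>k. ?r (\<alpha> * real k + 1)) \<longlonglongrightarrow> 0"
    by (rule filterlim_compose)
  then have "(\<lambda>k. \<bar>u\<bar> * ?r (\<alpha> * real k + 1)) \<longlonglongrightarrow> \<bar>u\<bar> * 0"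
    by (rule tendsto_mult_left)
  then have "\<forall>\<^sub>F k in sequentially. \<bar>u\<bar> * ?r (\<alpha> * real k + 1) < 1 / 2"
    by (rule order_tendstoD) auto
  then obtain N where N: "\<And>k. k \<ge> N \<Longrightarrow> \<bar>u\<bar> * ?r (\<alpha> * real k + 1) < 1 / 2"
    by (auto simp: eventually_sequentially)
  show ?thesis
  proof (rule summable_ratio_test[of "1 / 2" N])
    fix k assume k: "N \<le> k"
    have x: "0 < \<alpha> * real k + 1" using \<alpha> by (simp add: add_nonneg_pos)
    have pos: "0 < Gamma (\<alpha> * real k + 1)" "0 < Gamma (\<alpha> * real k + 1 + \<alpha>)"
      using x \<alpha> by (auto intro!: Gamma_real_pos)
    have eq: "\<alpha> * real (Suc k) + 1 = \<alpha> * real k + 1 + \<alpha>" by (simp add: algebra_simps)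
    have "\<bar>u\<bar> * (Gamma (\<alpha> * real k + 1) / Gamma (\<alpha> * real k + 1 + \<alpha>)) \<le> \<bar>u\<bar> * ?r (\<alpha> * real k + 1)"
      by (intro mult_left_mono Gamma_ratio_bound) (use x \<alpha> in auto)
    also have "\<dots> \<le> 1 / 2" using N[OF k] by simp
    finally have *: "\<bar>u\<bar> / Gamma (\<alpha> * real k + 1 + \<alpha>) \<le> 1 / 2 / Gamma (\<alpha> * real k + 1)"
      using pos by (simp add: field_simps)
    have "\<bar>u\<bar> ^ k * (\<bar>u\<bar> / Gamma (\<alpha> * real k + 1 + \<alpha>)) \<le> \<bar>u\<bar> ^ k * (1 / 2 / Gamma (\<alpha> * real k + 1))"
      using * by (rule mult_left_mono) simp
    then show "norm (u ^ Suc k / Gamma (\<alpha> * real (Suc k) + 1))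
        \<le> 1 / 2 * norm (u ^ k / Gamma (\<alpha> * real k + 1))"
      unfolding eq using pos by (simp add: abs_mult power_abs field_simps)
  qed simp
qed

lemma mittag_leffler_mono:
  assumes \<alpha>: "0 < \<alpha>" "\<alpha> < 1" and uv: "0 \<le> u" "u \<le> v"
  shows "mittag_leffler \<alpha> u \<le> mittag_leffler \<alpha> v"
  unfolding mittag_leffler_def
proof (rule suminf_le[OF _ summable_mittag_leffler summable_mittag_leffler])
  show "u ^ k / Gamma (\<alpha> * real k + 1) \<le> v ^ k / Gamma (\<alpha> * real k + 1)" for k
    using uv \<alpha> less_imp_le[OF Gamma_real_pos[of "\<alpha> * real k + 1"]]
    by (intro divide_right_mono power_mono) (auto simp: add_nonneg_pos)
qed (use \<alpha> in auto)

lemma mittag_leffler_zero: "mittag_leffler \<alpha> 0 = 1"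
proof -
  have "mittag_leffler \<alpha> 0 = (\<Sum>k. (if k = 0 then 1 else 0 :: real))"
    unfolding mittag_leffler_def by (rule suminf_cong) simp
  also have "\<dots> = 1"
    by (subst suminf_finite[of "{0}"]) auto
  finally show ?thesis .
qed

lemma mittag_leffler_ge_1:
  assumes "0 < \<alpha>" "\<alpha> < 1" "0 \<le> u"
  shows "1 \<le> mittag_leffler \<alpha> u"
  using mittag_leffler_mono[OF assms(1,2) order_refl assms(3)] by (simp add: mittag_leffler_zero)

section \<open>The Riemann-Liouville integral in a Banach space\<close>

definition frac_integral :: "real \<Rightarrow> (real \<Rightarrow> 'a::real_normed_vector) \<Rightarrow> real \<Rightarrow> 'a" where
  "frac_integral \<alpha> z t = (1 / Gamma \<alpha>) *\<^sub>R integral {0..t} (\<lambda>s. (t - s) powr (\<alpha> - 1) *\<^sub>R z s)"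

text \<open>
  The kernel is singular at \<open>s = t\<close>. The substitution \<open>u = (t - s)\<^sup>\<alpha>\<close> removes the singularity: the
  transformed integrand is continuous, its indefinite integral \<open>G\<close> gives the primitive
  \<open>- G ((t - s)\<^sup>\<alpha>) / \<alpha>\<close>, and the fundamental theorem of calculus needs the derivative of this
  primitive in the interior only.
\<close>

lemma has_integral_frac_kernel:
  fixes z :: "real \<Rightarrow> 'a::banach"
  assumes \<alpha>: "0 < \<alpha>" and t: "0 \<le> t" and z: "continuous_on {0..t} z"
  shows "((\<lambda>s. (t - s) powr (\<alpha> - 1) *\<^sub>R z s) has_integral
    (1 / \<alpha>) *\<^sub>R integral {0..t powr \<alpha>} (\<lambda>u. z (t - u powr (1 / \<alpha>)))) {0..t}"
proof -
  let ?w = "\<lambda>u. z (t - u powr (1 / \<alpha>))"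
  let ?G = "\<lambda>v. integral {0..v} ?w"
  let ?F = "\<lambda>s. - ((1 / \<alpha>) *\<^sub>R ?G ((t - s) powr \<alpha>))"
  have inv: "(v powr \<alpha>) powr (1 / \<alpha>) = v" if "0 \<le> v" for v :: real
    using \<alpha> that by (simp add: powr_powr)
  have w: "continuous_on {0..t powr \<alpha>} ?w"
  proof (rule continuous_on_compose2[OF z])
    show "continuous_on {0..t powr \<alpha>} (\<lambda>u. t - u powr (1 / \<alpha>))"
      using \<alpha> by (intro continuous_intros continuous_on_powr') auto
    show "(\<lambda>u. t - u powr (1 / \<alpha>)) ` {0..t powr \<alpha>} \<subseteq> {0..t}"
    proof (intro image_subsetI)
      fix u assume u: "u \<in> {0..t powr \<alpha>}"
      then have "u powr (1 / \<alpha>) \<le> (t powr \<alpha>) powr (1 / \<alpha>)"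
        using \<alpha> by (intro powr_mono2) auto
      then show "t - u powr (1 / \<alpha>) \<in> {0..t}" using inv[OF t] by simp
    qed
  qed
  have "((\<lambda>s. (t - s) powr (\<alpha> - 1) *\<^sub>R z s) has_integral (?F t - ?F 0)) {0..t}"
  proof (rule fundamental_theorem_of_calculus_interior[OF t])
    have G: "continuous_on {0..t powr \<alpha>} ?G"
      by (intro indefinite_integral_continuous_1 integrable_continuous_real w)
    show "continuous_on {0..t} ?F"
      by (intro continuous_intros continuous_on_compose2[OF G] continuous_on_powr')
        (use \<alpha> in \<open>auto intro!: powr_mono2\<close>)
    fix s assume s: "s \<in> {0<..<t}"
    then have lt: "0 < (t - s) powr \<alpha>" "(t - s) powr \<alpha> < t powr \<alpha>"
      using \<alpha> by (auto intro!: powr_less_mono2)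
    have "(?G has_vector_derivative ?w ((t - s) powr \<alpha>)) (at ((t - s) powr \<alpha>) within {0..t powr \<alpha>})"
      by (rule integral_has_vector_derivative[OF w]) (use lt in auto)
    then have "(?G has_vector_derivative ?w ((t - s) powr \<alpha>)) (at ((t - s) powr \<alpha>))"
      using lt by (simp add: at_within_Icc_at)
    then have G': "(?G has_vector_derivative z s) (at ((t - s) powr \<alpha>))"
      using inv[of "t - s"] s by simp
    have p: "((\<lambda>s. (t - s) powr \<alpha>) has_vector_derivative (- (\<alpha> * (t - s) powr (\<alpha> - 1)))) (at s)"
      unfolding has_real_derivative_iff_has_vector_derivative[symmetric]
      using s by (auto intro!: derivative_eq_intros)
    have "(?G \<circ> (\<lambda>s. (t - s) powr \<alpha>) has_vector_derivative
        (- (\<alpha> * (t - s) powr (\<alpha> - 1))) *\<^sub>R z s) (at s)"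
      by (rule vector_diff_chain_at[OF p G'])
    then have "((\<lambda>s. (- (1 / \<alpha>)) *\<^sub>R ?G ((t - s) powr \<alpha>)) has_vector_derivative
        (- (1 / \<alpha>)) *\<^sub>R ((- (\<alpha> * (t - s) powr (\<alpha> - 1))) *\<^sub>R z s)) (at s)"
      unfolding o_def by (intro derivative_eq_intros) auto
    then show "(?F has_vector_derivative (t - s) powr (\<alpha> - 1) *\<^sub>R z s) (at s)"
      using \<alpha> by simp
  qed
  then show ?thesis by simp
qed

lemma frac_kernel_integrable:
  fixes z :: "real \<Rightarrow> 'a::banach"
  assumes "0 < \<alpha>" and "0 \<le> t" and "continuous_on {0..t} z"
  shows "(\<lambda>s. (t - s) powr (\<alpha> - 1) *\<^sub>R z s) integrable_on {0..t}"
  using has_integral_frac_kernel[OF assms] by blast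

lemma frac_integral_const:
  fixes c :: "'a::banach"
  assumes "0 < \<alpha>" and "0 \<le> t"
  shows "frac_integral \<alpha> (\<lambda>_. c) t = (t powr \<alpha> / Gamma (\<alpha> + 1)) *\<^sub>R c"
proof -
  have g: "Gamma (\<alpha> + 1) = \<alpha> * Gamma \<alpha>"
    using assms by (auto intro!: Gamma_plus1 elim!: nonpos_Ints_cases)
  have "integral {0..t} (\<lambda>s. (t - s) powr (\<alpha> - 1) *\<^sub>R c) = (1 / \<alpha>) *\<^sub>R (t powr \<alpha> *\<^sub>R c)"
    using integral_unique[OF has_integral_frac_kernel[OF assms, of "\<lambda>_. c"]] by simp
  then show ?thesis unfolding frac_integral_def g by simp
qed

lemma frac_integral_diff:
  fixes z w :: "real \<Rightarrow> 'a::banach"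
  assumes "0 < \<alpha>" and "0 \<le> t" and "continuous_on {0..t} z" and "continuous_on {0..t} w"
  shows "frac_integral \<alpha> (\<lambda>s. z s - w s) t = frac_integral \<alpha> z t - frac_integral \<alpha> w t"
  unfolding frac_integral_def scaleR_diff_right
  by (subst integral_diff) (auto intro!: frac_kernel_integrable assms simp: scaleR_diff_right)

lemma frac_integral_cong:
  assumes "\<And>s. 0 \<le> s \<Longrightarrow> s \<le> t \<Longrightarrow> z s = w s"
  shows "frac_integral \<alpha> z t = frac_integral \<alpha> w t"
  unfolding frac_integral_def by (intro arg_cong2[where f=scaleR] refl integral_cong) (use assms in auto)

lemma frac_integral_norm_bound:
  fixes z :: "real \<Rightarrow> 'a::banach" and \<phi> :: "real \<Rightarrow> real"
  assumes \<alpha>: "0 < \<alpha>" and t: "0 \<le> t" and z: "continuous_on {0..t} z"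
    and \<phi>: "(\<lambda>s. (t - s) powr (\<alpha> - 1) * \<phi> s) integrable_on {0..t}"
    and le: "\<And>s. 0 \<le> s \<Longrightarrow> s \<le> t \<Longrightarrow> norm (z s) \<le> \<phi> s"
  shows "norm (frac_integral \<alpha> z t) \<le> frac_integral \<alpha> \<phi> t"
proof -
  have "norm (integral {0..t} (\<lambda>s. (t - s) powr (\<alpha> - 1) *\<^sub>R z s))
      \<le> integral {0..t} (\<lambda>s. (t - s) powr (\<alpha> - 1) * \<phi> s)"
    by (rule integral_norm_bound_integral[OF frac_kernel_integrable[OF \<alpha> t z] \<phi>])
      (use le in \<open>auto intro!: mult_left_mono\<close>)
  moreover have "0 < Gamma \<alpha>" using \<alpha> by (rule Gamma_real_pos)
  ultimately show ?thesis
    by (simp add: frac_integral_def divide_right_mono)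
qed

lemma frac_integral_const_bound:
  fixes z :: "real \<Rightarrow> 'a::banach"
  assumes \<alpha>: "0 < \<alpha>" and t: "0 \<le> t" and z: "continuous_on {0..t} z"
    and le: "\<And>s. 0 \<le> s \<Longrightarrow> s \<le> t \<Longrightarrow> norm (z s) \<le> c"
  shows "norm (frac_integral \<alpha> z t) \<le> c * t powr \<alpha> / Gamma (\<alpha> + 1)"
proof -
  have "norm (frac_integral \<alpha> z t) \<le> frac_integral \<alpha> (\<lambda>_. c) t"
    by (rule frac_integral_norm_bound[OF \<alpha> t z _ le])
      (use frac_kernel_integrable[OF \<alpha> t, of "\<lambda>_. c"] in auto)
  then show ?thesis by (simp add: frac_integral_const[OF \<alpha> t] mult.commute)
qed

text \<open>
  Delaying a function that vanishes on the negative half-line delays its fractional integral.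
  This turns an increment of \<open>frac_integral \<alpha> z\<close> into the fractional integral of an increment of
  \<open>z\<close>, both taken at the same time.
\<close>

lemma frac_integral_shift:
  fixes z :: "real \<Rightarrow> 'a::banach"
  assumes \<alpha>: "0 < \<alpha>" and t: "0 \<le> t" and h: "0 \<le> h" and z: "continuous_on {0..t} z"
    and zero: "\<And>s. s \<le> 0 \<Longrightarrow> z s = 0"
  shows "frac_integral \<alpha> (\<lambda>s. z (s - h)) (t + h) = frac_integral \<alpha> z t"
proof -
  let ?I = "integral {0..t} (\<lambda>s. (t - s) powr (\<alpha> - 1) *\<^sub>R z s)"
  have "((\<lambda>s. (t - s) powr (\<alpha> - 1) *\<^sub>R z s) has_integral ?I) {0..t}"
    by (intro integrable_integral frac_kernel_integrable \<alpha> t z)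
  from has_integral_shift_real_ivl[OF this, of "- h"]
  have "((\<lambda>s. (t + h - s) powr (\<alpha> - 1) *\<^sub>R z (s - h)) has_integral ?I) {h..t + h}"
    by (simp add: algebra_simps)
  moreover have "((\<lambda>s. (t + h - s) powr (\<alpha> - 1) *\<^sub>R z (s - h)) has_integral 0) {0..h}"
    by (rule has_integral_is_0) (use zero in auto)
  ultimately have "((\<lambda>s. (t + h - s) powr (\<alpha> - 1) *\<^sub>R z (s - h)) has_integral 0 + ?I) {0..t + h}"
    using t h by (intro has_integral_combine[of 0 h]) auto
  then show ?thesis
    unfolding frac_integral_def by (simp add: integral_unique)
qed

section \<open>Fractional integration of the Mittag-Leffler weight\<close>

text \<open>
  The Beta integral, rescaled from \<open>{0..1}\<close> to \<open>{0..t}\<close>.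
\<close>

lemma has_integral_frac_kernel_powr:
  fixes \<alpha> b t :: real
  assumes \<alpha>: "0 < \<alpha>" and t: "0 < t" and b: "0 \<le> b"
  shows "((\<lambda>s. (t - s) powr (\<alpha> - 1) * s powr b) has_integral
    t powr (b + \<alpha>) * Beta (b + 1) \<alpha>) {0..t}"
proof -
  have "((\<lambda>x. x powr b * (1 - x) powr (\<alpha> - 1)) has_integral Beta (b + 1) \<alpha>) {0..1}"
    using has_integral_Beta_real[of "b + 1" \<alpha>] \<alpha> b by simp
  from has_integral_stretch_real[OF this, of "1 / t"] t
  have "((\<lambda>x. (x / t) powr b * (1 - x / t) powr (\<alpha> - 1)) has_integral t * Beta (b + 1) \<alpha>) ((\<lambda>x. t * x) ` {0..1})"
    by (simp add: mult.commute)
  moreover have "(\<lambda>x. t * x) ` {0..1} = {0..t}"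
    using t by (simp add: image_mult_atLeastAtMost)
  ultimately have "((\<lambda>x. (x / t) powr b * (1 - x / t) powr (\<alpha> - 1)) has_integral t * Beta (b + 1) \<alpha>) {0..t}"
    by simp
  from has_integral_mult_right[OF this, of "t powr (b + \<alpha> - 1)"]
  have *: "((\<lambda>x. t powr (b + \<alpha> - 1) * ((x / t) powr b * (1 - x / t) powr (\<alpha> - 1))) has_integral
      t powr (b + \<alpha> - 1) * (t * Beta (b + 1) \<alpha>)) {0..t}" .
  have val: "t powr (b + \<alpha> - 1) * (t * Beta (b + 1) \<alpha>) = t powr (b + \<alpha>) * Beta (b + 1) \<alpha>"
    using t by (simp add: powr_diff)
  have "t powr (b + \<alpha> - 1) * ((s / t) powr b * (1 - s / t) powr (\<alpha> - 1))
      = (t - s) powr (\<alpha> - 1) * s powr b" if s: "s \<in> {0..t}" for s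
  proof -
    have "1 - s / t = (t - s) / t" using t by (simp add: diff_divide_distrib)
    moreover have "t powr (b + \<alpha> - 1) = t powr b * t powr (\<alpha> - 1)"
      by (simp add: powr_add[symmetric] algebra_simps)
    ultimately show ?thesis
      using s t by (simp add: powr_divide)
  qed
  from has_integral_eq[OF this *] show ?thesis
    unfolding val .
qed

text \<open>
  The fractional integral sends the \<open>k\<close>-th term of the series of \<open>E\<^sub>\<alpha> (\<theta> s\<^sup>\<alpha>)\<close> to the term with
  index \<open>k + 1\<close>, divided by \<open>\<theta>\<close>; so it sends the sum to \<open>(E\<^sub>\<alpha> (\<theta> t\<^sup>\<alpha>) - 1) / \<theta>\<close>. All terms are
  nonnegative, which permits integration term by term by monotone convergence.
\<close>

lemma has_integral_frac_kernel_mittag_leffler: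
  assumes \<alpha>: "0 < \<alpha>" "\<alpha> < 1" and \<theta>: "0 < \<theta>" and t: "0 < t"
  shows "((\<lambda>s. (t - s) powr (\<alpha> - 1) * mittag_leffler \<alpha> (\<theta> * s powr \<alpha>)) has_integral
    Gamma \<alpha> * ((mittag_leffler \<alpha> (\<theta> * t powr \<alpha>) - 1) / \<theta>)) {0..t}"
proof -
  define a where "a k s = (\<theta> * s powr \<alpha>) ^ k / Gamma (\<alpha> * real k + 1)" for k and s :: real
  have x: "0 < \<alpha> * real k + 1" for k using \<alpha> by (simp add: add_nonneg_pos)
  have a_nonneg: "0 \<le> a k s" for k s
    unfolding a_def using \<theta> Gamma_real_pos[OF x, of k] by (intro divide_nonneg_pos) auto
  have sums: "(\<lambda>k. a k s) sums mittag_leffler \<alpha> (\<theta> * s powr \<alpha>)" for s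
    unfolding a_def mittag_leffler_def
    by (intro summable_sums summable_mittag_leffler \<alpha>)
  have "(\<lambda>k. a (Suc k) t) sums (mittag_leffler \<alpha> (\<theta> * t powr \<alpha>) - a 0 t)"
    using sums[of t] sums_Suc_iff[of "\<lambda>k. a k t"] by simp
  then have sums': "(\<lambda>k. Gamma \<alpha> * (a (Suc k) t / \<theta>)) sums
      (Gamma \<alpha> * ((mittag_leffler \<alpha> (\<theta> * t powr \<alpha>) - 1) / \<theta>))"
    by (intro sums_mult sums_divide) (simp add: a_def)
  have int: "((\<lambda>s. (t - s) powr (\<alpha> - 1) * a k s) has_integral Gamma \<alpha> * (a (Suc k) t / \<theta>)) {0..t}" for k
  proof -
    have p: "(s powr \<alpha>) ^ k = s powr (\<alpha> * real k)" if "0 < s" for s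
      using that by (simp add: powr_powr flip: powr_realpow)
    have eq: "\<alpha> * real (Suc k) + 1 = \<alpha> * real k + 1 + \<alpha>" by (simp add: algebra_simps)
    have "((\<lambda>s. \<theta> ^ k / Gamma (\<alpha> * real k + 1) * ((t - s) powr (\<alpha> - 1) * s powr (\<alpha> * real k))) has_integral
        \<theta> ^ k / Gamma (\<alpha> * real k + 1) * (t powr (\<alpha> * real k + \<alpha>) * Beta (\<alpha> * real k + 1) \<alpha>)) {0..t}"
      using \<alpha> t by (intro has_integral_mult_right has_integral_frac_kernel_powr) auto
    then have "((\<lambda>s. (t - s) powr (\<alpha> - 1) * a k s) has_integral
        \<theta> ^ k / Gamma (\<alpha> * real k + 1) * (t powr (\<alpha> * real k + \<alpha>) * Beta (\<alpha> * real k + 1) \<alpha>)) {0..t}"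
      by (rule has_integral_spike_finite[rotated 2, where S="{0}"])
        (auto simp: a_def p power_mult_distrib)
    moreover have "\<theta> ^ k / Gamma (\<alpha> * real k + 1) * (t powr (\<alpha> * real k + \<alpha>) * Beta (\<alpha> * real k + 1) \<alpha>)
        = Gamma \<alpha> * (a (Suc k) t / \<theta>)"
    proof -
      have "a (Suc k) t = \<theta> ^ Suc k * t powr (\<alpha> * real k + \<alpha>) / Gamma (\<alpha> * real k + 1 + \<alpha>)"
        unfolding a_def eq using t p[OF t] by (simp add: power_mult_distrib powr_add)
      then show ?thesis
        using \<theta> Gamma_real_pos[OF x, of k] by (simp add: Beta_def field_simps)
    qed
    ultimately show ?thesis by simp
  qed
  show ?thesis
  proof (rule has_integral_monotone_convergence_increasing
      [where f = "\<lambda>n s. \<Sum>k<n. (t - s) powr (\<alpha> - 1) * a k s"])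
    show "((\<lambda>s. \<Sum>k<n. (t - s) powr (\<alpha> - 1) * a k s) has_integral
        (\<Sum>k<n. Gamma \<alpha> * (a (Suc k) t / \<theta>))) {0..t}" for n
      by (intro has_integral_sum int) auto
    show "(\<Sum>k<n. (t - s) powr (\<alpha> - 1) * a k s) \<le> (\<Sum>k<Suc n. (t - s) powr (\<alpha> - 1) * a k s)" for n s
      using a_nonneg by simp
    show "(\<lambda>n. \<Sum>k<n. (t - s) powr (\<alpha> - 1) * a k s)
        \<longlonglongrightarrow> (t - s) powr (\<alpha> - 1) * mittag_leffler \<alpha> (\<theta> * s powr \<alpha>)" for s
      using sums_mult[OF sums[of s]] by (simp add: sums_def)
    show "(\<lambda>n. \<Sum>k<n. Gamma \<alpha> * (a (Suc k) t / \<theta>))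
        \<longlonglongrightarrow> Gamma \<alpha> * ((mittag_leffler \<alpha> (\<theta> * t powr \<alpha>) - 1) / \<theta>)"
      using sums' by (simp add: sums_def)
  qed
qed

text \<open>
  The reason for the weight in the Bielecki norm: with respect to it, fractional integration
  has norm at most \<open>1 / \<theta>\<close>, whatever the length of the interval.
\<close>

lemma frac_integral_weighted_bound:
  fixes z :: "real \<Rightarrow> 'a::banach"
  assumes \<alpha>: "0 < \<alpha>" "\<alpha> < 1" and \<theta>: "0 < \<theta>" and t: "0 \<le> t" and z: "continuous_on {0..t} z"
    and c: "0 \<le> c"
    and le: "\<And>s. 0 \<le> s \<Longrightarrow> s \<le> t \<Longrightarrow> norm (z s) \<le> c * mittag_leffler \<alpha> (\<theta> * s powr \<alpha>)"
  shows "norm (frac_integral \<alpha> z t) \<le> c * mittag_leffler \<alpha> (\<theta> * t powr \<alpha>) / \<theta>"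
proof (cases "t = 0")
  case True
  then show ?thesis using c \<theta> by (simp add: frac_integral_def mittag_leffler_zero)
next
  case False
  with t have t0: "0 < t" by simp
  have *: "((\<lambda>s. (t - s) powr (\<alpha> - 1) * (c * mittag_leffler \<alpha> (\<theta> * s powr \<alpha>))) has_integral
      c * (Gamma \<alpha> * ((mittag_leffler \<alpha> (\<theta> * t powr \<alpha>) - 1) / \<theta>))) {0..t}"
    using has_integral_mult_right[OF has_integral_frac_kernel_mittag_leffler[OF \<alpha> \<theta> t0], of c]
    by (simp add: mult_ac)
  have "norm (frac_integral \<alpha> z t) \<le> frac_integral \<alpha> (\<lambda>s. c * mittag_leffler \<alpha> (\<theta> * s powr \<alpha>)) t"
    by (rule frac_integral_norm_bound[OF \<alpha>(1) t z _ le]) (use * in blast)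
  also have "\<dots> = c * ((mittag_leffler \<alpha> (\<theta> * t powr \<alpha>) - 1) / \<theta>)"
    using integral_unique[OF *] Gamma_real_pos[OF \<alpha>(1)] by (simp add: frac_integral_def)
  also have "\<dots> \<le> c * mittag_leffler \<alpha> (\<theta> * t powr \<alpha>) / \<theta>"
    using c \<theta> by (simp add: divide_right_mono mult_left_mono)
  finally show ?thesis .
qed

section \<open>Lipschitz solutions start at zero\<close>

text \<open>
  Near \<open>0\<close> the fractional integral behaves like \<open>(t\<^sup>\<alpha> / \<Gamma>(\<alpha> + 1)) z(0)\<close>. Since \<open>\<alpha> < 1\<close>, this
  is not \<open>O(t)\<close> unless \<open>z(0) = 0\<close>.
\<close>

lemma frac_integral_lipschitz_imp_zero:
  fixes z :: "real \<Rightarrow> 'a::banach"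
  assumes \<alpha>: "0 < \<alpha>" "\<alpha> < 1" and T: "0 < T" and z: "continuous_on {0..T} z"
    and L: "\<And>t. t \<in> {0..T} \<Longrightarrow> norm (frac_integral \<alpha> z t) \<le> L * t"
  shows "z 0 = 0"
proof (rule ccontr)
  assume "z 0 \<noteq> 0"
  define \<epsilon> where "\<epsilon> = norm (z 0) / 2"
  have \<epsilon>: "0 < \<epsilon>" using \<open>z 0 \<noteq> 0\<close> by (simp add: \<epsilon>_def)
  obtain \<delta> where \<delta>: "0 < \<delta>" and close: "\<And>s. s \<in> {0..T} \<Longrightarrow> dist s 0 < \<delta> \<Longrightarrow> dist (z s) (z 0) < \<epsilon>"
    using z T \<epsilon> unfolding continuous_on_iff by (metis atLeastAtMost_iff less_imp_le order_refl)
  let ?\<Gamma> = "Gamma (\<alpha> + 1)"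
  have \<Gamma>: "0 < ?\<Gamma>" using \<alpha> by (simp add: Gamma_real_pos)
  \<comment> \<open>Splitting \<open>z = z 0 + (z - z 0)\<close> leaves half of the leading term, of size
    \<open>\<epsilon> t\<^sup>\<alpha> / \<Gamma>(\<alpha> + 1)\<close>, to be dominated by \<open>L t\<close>; then \<open>t\<close> tends to \<open>0\<close>.\<close>
  have bound: "\<epsilon> \<le> L * ?\<Gamma> * t powr (1 - \<alpha>)" if t: "0 < t" "t < min \<delta> T" for t
  proof -
    have zt: "continuous_on {0..t} z" by (rule continuous_on_subset[OF z]) (use t in auto)
    have "norm (frac_integral \<alpha> (\<lambda>s. z s - z 0) t) \<le> \<epsilon> * t powr \<alpha> / ?\<Gamma>"
      by (rule frac_integral_const_bound)
        (use \<alpha> t close in \<open>auto intro!: continuous_intros zt less_imp_le simp: dist_norm\<close>)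
    moreover have "frac_integral \<alpha> (\<lambda>s. z s - z 0) t
        = frac_integral \<alpha> z t - (t powr \<alpha> / ?\<Gamma>) *\<^sub>R z 0"
      using \<alpha> t by (subst frac_integral_diff) (auto intro!: zt simp: frac_integral_const)
    ultimately have "norm ((t powr \<alpha> / ?\<Gamma>) *\<^sub>R z 0) \<le> norm (frac_integral \<alpha> z t) + \<epsilon> * t powr \<alpha> / ?\<Gamma>"
      using norm_triangle_ineq4[of "frac_integral \<alpha> z t"
          "frac_integral \<alpha> z t - (t powr \<alpha> / ?\<Gamma>) *\<^sub>R z 0"] by simp
    also have "\<dots> \<le> L * t + \<epsilon> * t powr \<alpha> / ?\<Gamma>"
      using L[of t] t by simp
    finally have "t powr \<alpha> / ?\<Gamma> * norm (z 0) \<le> L * t + \<epsilon> * t powr \<alpha> / ?\<Gamma>"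
      using \<Gamma> by simp
    moreover have "t powr \<alpha> / ?\<Gamma> * norm (z 0) = 2 * (\<epsilon> * t powr \<alpha> / ?\<Gamma>)"
      by (simp add: \<epsilon>_def)
    ultimately have "\<epsilon> * t powr \<alpha> / ?\<Gamma> \<le> L * t"
      by linarith
    then have "\<epsilon> * t powr \<alpha> \<le> L * ?\<Gamma> * t" using \<Gamma> by (simp add: field_simps)
    also have "L * ?\<Gamma> * t = L * ?\<Gamma> * t powr (1 - \<alpha>) * t powr \<alpha>"
      using t powr_add[of t "1 - \<alpha>" \<alpha>] by (simp add: mult.assoc)
    finally have "\<epsilon> * t powr \<alpha> \<le> L * ?\<Gamma> * t powr (1 - \<alpha>) * t powr \<alpha>" .
    then show ?thesis using t by simp
  qed
  have "((\<lambda>t. t powr (1 - \<alpha>)) \<longlongrightarrow> 0 powr (1 - \<alpha>)) (at_right 0)"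
    by (rule tendsto_powr'[OF tendsto_ident_at tendsto_const])
      (use \<alpha> in \<open>simp add: eventually_at_filter\<close>)
  then have "((\<lambda>t. L * ?\<Gamma> * t powr (1 - \<alpha>)) \<longlongrightarrow> 0) (at_right 0)"
    using tendsto_mult_right_zero[of "\<lambda>t. t powr (1 - \<alpha>)"] by simp
  moreover have "\<forall>\<^sub>F t in at_right 0. \<epsilon> \<le> L * ?\<Gamma> * t powr (1 - \<alpha>)"
    unfolding eventually_at_right_field using bound \<delta> T by (intro exI[of _ "min \<delta> T"]) auto
  ultimately have "\<epsilon> \<le> 0"
    by (rule tendsto_lowerbound) simp
  with \<epsilon> show False by simp
qed

section \<open>Contraction and stability in the weighted norm\<close>

locale mittag_leffler_weight =
  fixes \<alpha> \<theta> :: real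
  assumes \<alpha>: "0 < \<alpha>" "\<alpha> < 1" and \<theta>: "0 < \<theta>"
begin

definition W :: "real \<Rightarrow> real" where
  "W t = mittag_leffler \<alpha> (\<theta> * t powr \<alpha>)"

lemma W_ge_1: "1 \<le> W t"
  unfolding W_def using \<alpha> \<theta> by (intro mittag_leffler_ge_1) auto

lemma W_pos: "0 < W t"
  using W_ge_1[of t] by simp

lemma W_mono: "0 \<le> s \<Longrightarrow> s \<le> t \<Longrightarrow> W s \<le> W t"
  unfolding W_def using \<alpha> \<theta>
  by (intro mittag_leffler_mono mult_left_mono powr_mono2) auto

lemma frac_integral_W_bound:
  fixes z :: "real \<Rightarrow> 'a::banach"
  assumes "0 \<le> t" and "continuous_on {0..t} z" and "0 \<le> c"
    and "\<And>s. 0 \<le> s \<Longrightarrow> s \<le> t \<Longrightarrow> norm (z s) \<le> c * W s"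
  shows "norm (frac_integral \<alpha> z t) \<le> c * W t / \<theta>"
  using frac_integral_weighted_bound[OF \<alpha> \<theta> assms(1,2,3)] assms(4) unfolding W_def by blast

end

text \<open>
  The equation \<open>z = h(\<cdot>, I z, z)\<close> for a trajectory with \<open>z 0 = 0\<close>, where \<open>I\<close> is the fractional
  integral; for such a trajectory \<open>I z\<close> agrees with \<open>frac_primitive \<alpha> z\<close>.
\<close>

locale implicit_frac_equation = mittag_leffler_weight \<alpha> \<theta>
  for \<alpha> \<theta> :: real +
  fixes T M1 M2 M3 :: real and h :: "real \<Rightarrow> 'a::banach \<Rightarrow> 'a \<Rightarrow> 'a"
  assumes T: "0 < T" and M1: "0 < M1" and M2: "0 < M2" and M3: "0 < M3"
    and q_less_1: "M2 / \<theta> + M3 < 1"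
    and lip: "\<And>t1 t2 x1 x2 y1 y2. t1 \<in> {0..T} \<Longrightarrow> t2 \<in> {0..T} \<Longrightarrow>
      norm (h t1 x1 y1 - h t2 x2 y2) \<le> M1 * \<bar>t1 - t2\<bar> + M2 * norm (x1 - x2) + M3 * norm (y1 - y2)"
    and init: "h 0 0 0 = 0"
begin

text \<open>
  \<open>q\<close> is the contraction constant in the weighted norm. The slope \<open>\<l>\<close> solves
  \<open>M1 + q \<l> = \<l>\<close>, which is what makes the weighted Lipschitz condition below invariant.
\<close>

definition q :: real where "q = M2 / \<theta> + M3"

definition \<l> :: real where "\<l> = M1 / (1 - q)"

lemma q_pos: "0 < q" and q_lt_1: "q < 1"
  using M2 M3 \<theta> q_less_1 by (auto simp: q_def intro!: add_pos_pos)

lemma \<l>_pos: "0 < \<l>" and \<l>_eq: "\<l> - q * \<l> = M1"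
proof -
  show "0 < \<l>" using M1 q_lt_1 by (simp add: \<l>_def)
  have "\<l> - q * \<l> = (1 - q) * \<l>" by (simp add: left_diff_distrib)
  also have "\<dots> = M1" using q_lt_1 by (simp add: \<l>_def)
  finally show "\<l> - q * \<l> = M1" .
qed

lemma weighted_contraction:
  assumes t: "t \<in> {0..T}" and z: "continuous_on {0..t} z" and w: "continuous_on {0..t} w"
    and c: "0 \<le> c" and le: "\<And>s. 0 \<le> s \<Longrightarrow> s \<le> t \<Longrightarrow> norm (z s - w s) \<le> c * W s"
  shows "norm (h t (frac_integral \<alpha> z t) (z t) - h t (frac_integral \<alpha> w t) (w t)) \<le> q * c * W t"
proof -
  have I: "norm (frac_integral \<alpha> z t - frac_integral \<alpha> w t) \<le> c * W t / \<theta>"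
    using frac_integral_W_bound[of t "\<lambda>s. z s - w s" c] frac_integral_diff[of \<alpha> t z w]
      t z w c le \<alpha> by (auto intro!: continuous_intros)
  have "norm (h t (frac_integral \<alpha> z t) (z t) - h t (frac_integral \<alpha> w t) (w t))
      \<le> M2 * norm (frac_integral \<alpha> z t - frac_integral \<alpha> w t) + M3 * norm (z t - w t)"
    using lip[OF t t] by simp
  also have "\<dots> \<le> M2 * (c * W t / \<theta>) + M3 * (c * W t)"
    using I le[of t] t M2 M3 by (intro add_mono mult_left_mono) auto
  also have "\<dots> = q * c * W t" by (simp add: q_def algebra_simps)
  finally show ?thesis .
qed

text \<open>
  An approximate solution with defect at most \<open>K W\<close> is close to a solution: the weighted
  distance \<open>m\<close> satisfies \<open>m \<le> q m + K\<close> by the contraction property.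
\<close>

lemma stability:
  assumes z: "continuous_on {0..T} z" and w: "continuous_on {0..T} w"
    and z_sol: "\<And>t. t \<in> {0..T} \<Longrightarrow> z t = h t (frac_integral \<alpha> z t) (z t)"
    and w_sol: "\<And>t. t \<in> {0..T} \<Longrightarrow> norm (h t (frac_integral \<alpha> w t) (w t) - w t) \<le> K * W t"
    and t: "t \<in> {0..T}"
  shows "norm (z t - w t) \<le> K / (1 - q) * W t"
proof -
  let ?d = "\<lambda>t. norm (z t - w t) / W t"
  define m where "m = (SUP t\<in>{0..T}. ?d t)"
  \<comment> \<open>The supremum is finite because \<open>z - w\<close> is bounded and the weight is at least \<open>1\<close>.\<close>
  have "compact ((\<lambda>t. z t - w t) ` {0..T})"
    by (intro compact_continuous_image continuous_intros z w) auto
  then obtain C where C: "\<And>t. t \<in> {0..T} \<Longrightarrow> norm (z t - w t) \<le> C"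
    using compact_imp_bounded bounded_iff by (metis (no_types, lifting) image_eqI)
  have bdd: "bdd_above (?d ` {0..T})"
  proof (rule bdd_aboveI2)
    fix t assume t: "t \<in> {0..T}"
    have "?d t \<le> norm (z t - w t) / 1"
      using W_ge_1[of t] by (intro divide_left_mono) auto
    then show "?d t \<le> C" using C[OF t] by simp
  qed
  have d_le: "?d t \<le> m" if "t \<in> {0..T}" for t
    unfolding m_def by (rule cSUP_upper[OF that bdd])
  then have le: "norm (z t - w t) \<le> m * W t" if "t \<in> {0..T}" for t
    using d_le[OF that] W_pos[of t] by (simp add: pos_divide_le_eq)
  have m0: "0 \<le> m"
    using order_trans[OF _ d_le[of 0]] T W_pos[of 0] by simp
  have "m \<le> q * m + K"
    unfolding m_def
  proof (rule cSUP_least)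
    fix t assume t: "t \<in> {0..T}"
    have "norm (z t - w t) = norm (h t (frac_integral \<alpha> z t) (z t) - w t)"
      by (subst z_sol[OF t]) simp
    also have "\<dots> \<le> norm (h t (frac_integral \<alpha> z t) (z t) - h t (frac_integral \<alpha> w t) (w t))
        + norm (h t (frac_integral \<alpha> w t) (w t) - w t)"
      using norm_triangle_ineq by (metis diff_add_cancel add_diff_eq)
    also have "\<dots> \<le> q * m * W t + K * W t"
      using t by (intro add_mono weighted_contraction w_sol continuous_on_subset[OF z]
          continuous_on_subset[OF w] m0 le) auto
    finally show "?d t \<le> q * (SUP t\<in>{0..T}. ?d t) + K"
      using W_pos[of t] by (simp add: pos_divide_le_eq algebra_simps m_def[symmetric])
  qed (use T in auto)
  then have "m \<le> K / (1 - q)"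
    using q_lt_1 by (simp add: pos_le_divide_eq algebra_simps)
  then show ?thesis
    using le[OF t] W_pos[of t] by (meson mult_right_mono less_imp_le order_trans)
qed

section \<open>Existence of a Lipschitz solution\<close>

text \<open>
  The class in which the fixed point is sought. The factor \<open>W t\<close> is essential: the ordinary
  Lipschitz condition need not be preserved by the iteration on a long interval. The extension by
  \<open>0\<close> to negative times is what the shift argument for fractional integrals requires.
\<close>

definition admissible :: "(real \<Rightarrow> 'a) \<Rightarrow> bool" where
  "admissible z \<longleftrightarrow> (\<forall>t\<le>0. z t = 0) \<and>
     (\<forall>s t. 0 \<le> s \<longrightarrow> s \<le> t \<longrightarrow> t \<le> T \<longrightarrow> norm (z t - z s) \<le> \<l> * (t - s) * W t)"

text \<open>
  The value \<open>0\<close> for negative times keeps the iterates in the admissible class. At \<open>t = 0\<close> both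
  branches agree for an admissible argument, by the initial condition \<open>h 0 0 0 = 0\<close>.
\<close>

definition picard_step :: "(real \<Rightarrow> 'a) \<Rightarrow> real \<Rightarrow> 'a" where
  "picard_step z t = (if t \<le> 0 then 0 else h t (frac_integral \<alpha> z t) (z t))"

lemma admissible_zero: "admissible z \<Longrightarrow> t \<le> 0 \<Longrightarrow> z t = 0"
  by (simp add: admissible_def)

lemma admissible_diff:
  assumes z: "admissible z" and st: "s \<le> t" "t \<le> T"
  shows "norm (z t - z s) \<le> \<l> * (t - s) * W t"
proof -
  have *: "norm (z v - z u) \<le> \<l> * (v - u) * W v" if "0 \<le> u" "u \<le> v" "v \<le> T" for u v
    using z that by (simp add: admissible_def)
  have nonneg: "0 \<le> \<l> * (t - s) * W t"
    using \<l>_pos W_pos[of t] st by (intro mult_nonneg_nonneg) auto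
  consider "0 \<le> s" | "s < 0" "t \<le> 0" | "s < 0" "0 < t" by linarith
  then show ?thesis
  proof cases
    case 3
    have "norm (z t - z s) = norm (z t - z 0)" using 3 admissible_zero[OF z] by simp
    also have "\<dots> \<le> \<l> * (t - 0) * W t" by (rule *) (use 3 st in auto)
    also have "\<dots> \<le> \<l> * (t - s) * W t"
      using 3 \<l>_pos W_pos[of t] by (intro mult_right_mono mult_left_mono) auto
    finally show ?thesis .
  qed (use * st admissible_zero[OF z] nonneg in auto)
qed

lemma admissible_continuous:
  assumes z: "admissible z"
  shows "continuous_on {0..T} z"
proof -
  have *: "norm (z t - z s) \<le> \<l> * W T * (t - s)" if "0 \<le> s" "s \<le> t" "t \<le> T" for s t
  proof -
    have "norm (z t - z s) \<le> \<l> * (t - s) * W t" using admissible_diff[OF z] that by simp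
    also have "\<dots> \<le> \<l> * (t - s) * W T"
      using that \<l>_pos by (intro mult_left_mono W_mono) auto
    finally show ?thesis by (simp add: mult_ac)
  qed
  have "(\<l> * W T)-lipschitz_on {0..T} z"
  proof (rule lipschitz_onI)
    fix s t assume "s \<in> {0..T}" "t \<in> {0..T}"
    then show "dist (z s) (z t) \<le> \<l> * W T * dist s t"
      using *[of s t] *[of t s] by (cases "s \<le> t") (auto simp: dist_norm norm_minus_commute)
  qed (use \<l>_pos W_pos[of T] in simp)
  then show ?thesis by (rule lipschitz_on_continuous_on)
qed

text \<open>
  With \<open>h = t - s\<close>, the increment is the fractional integral at \<open>t\<close> of \<open>z - z(\<cdot> - h)\<close>, and this
  function is at most \<open>\<l> h W\<close> by admissibility; integration costs the factor \<open>1 / \<theta>\<close>.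
\<close>

lemma frac_integral_admissible:
  assumes z: "admissible z" and st: "0 \<le> s" "s \<le> t" "t \<le> T"
  shows "norm (frac_integral \<alpha> z t - frac_integral \<alpha> z s) \<le> \<l> * (t - s) * W t / \<theta>"
proof -
  let ?h = "t - s"
  have cont: "continuous_on {0..u} z" if "u \<le> T" for u
    by (rule continuous_on_subset[OF admissible_continuous[OF z]]) (use that in auto)
  have "continuous_on {..T} z"
  proof -
    have "continuous_on ({..0} \<union> {0..T}) z"
      by (rule continuous_on_closed_Un)
        (use admissible_zero[OF z] cont in \<open>auto intro: continuous_on_eq[OF continuous_on_const[of _ 0]]\<close>)
    moreover have "{..0} \<union> {0..T} = {..T}" using T by auto
    ultimately show ?thesis by simp
  qed
  then have cont_shift: "continuous_on {0..t} (\<lambda>r. z (r - ?h))"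
    by (rule continuous_on_compose2) (use st in \<open>auto intro!: continuous_intros\<close>)
  have "frac_integral \<alpha> (\<lambda>r. z (r - ?h)) (s + ?h) = frac_integral \<alpha> z s"
    by (rule frac_integral_shift) (use st \<alpha> cont admissible_zero[OF z] in auto)
  then have "frac_integral \<alpha> z t - frac_integral \<alpha> z s = frac_integral \<alpha> (\<lambda>r. z r - z (r - ?h)) t"
    using frac_integral_diff[OF \<alpha>(1) _ cont cont_shift] st by simp
  also have "norm \<dots> \<le> \<l> * ?h * W t / \<theta>"
  proof (rule frac_integral_W_bound)
    show "continuous_on {0..t} (\<lambda>r. z r - z (r - ?h))"
      using st by (intro continuous_intros cont cont_shift) auto
    show "norm (z r - z (r - ?h)) \<le> \<l> * ?h * W r" if "0 \<le> r" "r \<le> t" for r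
      using admissible_diff[OF z, of "r - ?h" r] that st by simp
  qed (use st \<l>_pos in auto)
  finally show ?thesis .
qed

lemma frac_integral_zero: "frac_integral \<alpha> z 0 = 0"
  by (simp add: frac_integral_def)

lemma picard_step_eq:
  assumes "admissible z" "0 \<le> t"
  shows "picard_step z t = h t (frac_integral \<alpha> z t) (z t)"
  using assms admissible_zero[of z 0] init by (cases "t = 0") (auto simp: picard_step_def frac_integral_zero)

text \<open>
  The three Lipschitz terms contribute at most \<open>M1 + (M2 / \<theta> + M3) \<l> = \<l>\<close> times
  \<open>(t - s) W t\<close>; the first of them uses \<open>1 \<le> W t\<close>.
\<close>

lemma picard_step_admissible:
  assumes z: "admissible z"
  shows "admissible (picard_step z)"
  unfolding admissible_def
proof (intro conjI allI impI)
  fix s t :: real assume st: "0 \<le> s" "s \<le> t" "t \<le> T"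
  let ?I = "frac_integral \<alpha> z"
  have "norm (picard_step z t - picard_step z s) = norm (h t (?I t) (z t) - h s (?I s) (z s))"
    using st by (simp add: picard_step_eq[OF z])
  also have "\<dots> \<le> M1 * \<bar>t - s\<bar> + M2 * norm (?I t - ?I s) + M3 * norm (z t - z s)"
    by (rule lip) (use st in auto)
  also have "M1 * \<bar>t - s\<bar> \<le> M1 * (t - s) * W t"
    using mult_left_mono[OF W_ge_1[of t], of "M1 * (t - s)"] st M1 by simp
  also have "M1 * (t - s) * W t + M2 * norm (?I t - ?I s) + M3 * norm (z t - z s)
      \<le> M1 * (t - s) * W t + M2 * (\<l> * (t - s) * W t / \<theta>) + M3 * (\<l> * (t - s) * W t)"
    using st M2 M3 M1
    by (intro add_mono order_refl mult_left_mono frac_integral_admissible[OF z] admissible_diff[OF z]) auto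
  also have "\<dots> = (M1 + q * \<l>) * ((t - s) * W t)"
    by (simp add: q_def algebra_simps add_divide_distrib diff_divide_distrib)
  also have "M1 + q * \<l> = \<l>" using \<l>_eq by linarith
  finally show "norm (picard_step z t - picard_step z s) \<le> \<l> * (t - s) * W t" by (simp add: mult_ac)
qed (simp add: picard_step_def)

definition picard :: "nat \<Rightarrow> real \<Rightarrow> 'a" where
  "picard n = (picard_step ^^ n) (\<lambda>_. 0)"

lemma picard_Suc: "picard (Suc n) = picard_step (picard n)"
  by (simp add: picard_def)

lemma picard_admissible: "admissible (picard n)"
proof (induction n)
  case 0
  show ?case using \<l>_pos W_pos by (auto simp: admissible_def picard_def intro!: mult_nonneg_nonneg less_imp_le[OF W_pos])
next
  case (Suc n)
  then show ?case unfolding picard_Suc by (rule picard_step_admissible)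
qed

lemma continuous_picard: "t \<le> T \<Longrightarrow> continuous_on {0..t} (picard n)"
  by (rule continuous_on_subset[OF admissible_continuous[OF picard_admissible]]) auto

lemma picard_increment:
  assumes "t \<in> {0..T}"
  shows "norm (picard (Suc n) t - picard n t) \<le> \<l> * T * q ^ n * W t"
  using assms
proof (induction n arbitrary: t)
  case 0
  have "norm (picard 1 t - picard 1 0) \<le> \<l> * (t - 0) * W t"
    by (rule admissible_diff[OF picard_admissible]) (use 0 in auto)
  also have "\<dots> \<le> \<l> * T * W t"
    using 0 \<l>_pos W_pos[of t] by (intro mult_right_mono mult_left_mono) auto
  finally show ?case
    using admissible_zero[OF picard_admissible, of 0 1] by (simp add: picard_def)
next
  case (Suc n)
  have "norm (picard_step (picard (Suc n)) t - picard_step (picard n) t) \<le> q * (\<l> * T * q ^ n) * W t"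
    using Suc.prems \<l>_pos T q_pos
    by (subst (1 2) picard_step_eq[OF picard_admissible])
      (auto intro!: weighted_contraction continuous_picard Suc.IH)
  then show ?case by (simp add: picard_Suc mult_ac)
qed

definition picard_limit :: "real \<Rightarrow> 'a" where
  "picard_limit t = lim (\<lambda>n. picard n t)"

lemma picard_limit:
  assumes t: "t \<in> {0..T}"
  shows "(\<lambda>n. picard n t) \<longlonglongrightarrow> picard_limit t"
    and "norm (picard n t - picard_limit t) \<le> \<l> * T * q ^ n / (1 - q) * W t"
proof -
  let ?d = "\<lambda>n. picard (Suc n) t - picard n t"
  let ?C = "\<l> * T * W t"
  have geom: "(\<lambda>n. ?C * q ^ n) sums (?C * (1 / (1 - q)))"
    using q_pos q_lt_1 by (intro sums_mult geometric_sums) auto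
  have le: "norm (?d n) \<le> ?C * q ^ n" for n
    using picard_increment[OF t, of n] by (simp add: mult_ac)
  have d: "summable ?d"
    by (rule summable_comparison_test'[OF sums_summable[OF geom]]) (use le in auto)
  have partial: "(\<Sum>k<n. ?d k) = picard n t" for n
    using sum_lessThan_telescope[of "\<lambda>k. picard k t" n] by (simp add: picard_def[of 0])
  have lim: "(\<lambda>n. picard n t) \<longlonglongrightarrow> suminf ?d"
    using summable_LIMSEQ[OF d] unfolding partial .
  then have eq: "picard_limit t = suminf ?d"
    unfolding picard_limit_def by (rule limI)
  show "(\<lambda>n. picard n t) \<longlonglongrightarrow> picard_limit t" unfolding eq by (rule lim)
  have "picard_limit t - picard n t = (\<Sum>k. ?d (k + n))"
    using suminf_minus_initial_segment[OF d, of n] unfolding eq partial by simp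
  also have "norm \<dots> \<le> (\<Sum>k. ?C * q ^ n * q ^ k)"
  proof (rule norm_suminf_le)
    show "norm (?d (k + n)) \<le> ?C * q ^ n * q ^ k" for k
      using le[of "k + n"] by (simp add: power_add mult_ac)
    show "summable (\<lambda>k. ?C * q ^ n * q ^ k)"
      using q_pos q_lt_1 by (intro summable_mult summable_geometric) auto
  qed
  also have "\<dots> = ?C * q ^ n * (1 / (1 - q))"
    using q_pos q_lt_1 by (intro sums_unique[symmetric] sums_mult geometric_sums) auto
  finally show "norm (picard n t - picard_limit t) \<le> \<l> * T * q ^ n / (1 - q) * W t"
    by (simp add: norm_minus_commute mult_ac)
qed

lemma picard_limit_admissible: "admissible picard_limit"
  unfolding admissible_def
proof (intro conjI allI impI)
  fix t :: real assume "t \<le> 0"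
  then show "picard_limit t = 0"
    using admissible_zero[OF picard_admissible] by (simp add: picard_limit_def)
next
  fix s t :: real assume st: "0 \<le> s" "s \<le> t" "t \<le> T"
  have "(\<lambda>n. norm (picard n t - picard n s)) \<longlonglongrightarrow> norm (picard_limit t - picard_limit s)"
    using st by (intro tendsto_intros picard_limit(1)) auto
  then show "norm (picard_limit t - picard_limit s) \<le> \<l> * (t - s) * W t"
    by (rule LIMSEQ_le_const2) (use admissible_diff[OF picard_admissible] st in auto)
qed

text \<open>
  The iterates converge to the limit at a geometric rate in the weighted norm, so the
  contraction property allows passage to the limit on the right-hand side.
\<close>

lemma picard_limit_solves:
  assumes t: "t \<in> {0..T}"
  shows "picard_limit t = h t (frac_integral \<alpha> picard_limit t) (picard_limit t)"
proof -
  let ?R = "h t (frac_integral \<alpha> picard_limit t) (picard_limit t)"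
  have "(\<lambda>n. q * (\<l> * T * q ^ n / (1 - q)) * W t) \<longlonglongrightarrow> q * (\<l> * T * 0 / (1 - q)) * W t"
    using q_pos q_lt_1 by (intro tendsto_intros LIMSEQ_power_zero) auto
  then have lim0: "(\<lambda>n. q * (\<l> * T * q ^ n / (1 - q)) * W t) \<longlonglongrightarrow> 0" by simp
  have bound: "norm (picard (Suc n) t - ?R) \<le> q * (\<l> * T * q ^ n / (1 - q)) * W t" for n
  proof -
    have "norm (picard (Suc n) t - ?R) = norm (h t (frac_integral \<alpha> (picard n) t) (picard n t) - ?R)"
      using t by (simp add: picard_Suc picard_step_eq[OF picard_admissible])
    also have "\<dots> \<le> q * (\<l> * T * q ^ n / (1 - q)) * W t"
    proof (rule weighted_contraction[OF t])
      show "continuous_on {0..t} picard_limit"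
        by (rule continuous_on_subset[OF admissible_continuous[OF picard_limit_admissible]])
          (use t in auto)
      show "norm (picard n s - picard_limit s) \<le> \<l> * T * q ^ n / (1 - q) * W s" if "0 \<le> s" "s \<le> t" for s
        by (rule picard_limit(2)) (use that t in auto)
    qed (use t q_pos q_lt_1 \<l>_pos T continuous_picard in auto)
    finally show ?thesis .
  qed
  have "(\<lambda>n. picard (Suc n) t - ?R) \<longlonglongrightarrow> 0"
    by (rule Lim_null_comparison[OF _ lim0]) (use bound in auto)
  then have "(\<lambda>n. picard (Suc n) t) \<longlonglongrightarrow> ?R"
    by (simp add: LIM_zero_iff)
  moreover have "(\<lambda>n. picard (Suc n) t) \<longlonglongrightarrow> picard_limit t"
    using picard_limit(1)[OF t] by (rule LIMSEQ_Suc)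
  ultimately show ?thesis using LIMSEQ_unique by blast
qed

text \<open>
  The Lipschitz constant of \<open>frac_integral \<alpha> z\<close> for admissible \<open>z\<close>. Like \<open>q\<close> and \<open>\<l>\<close>, it does not
  involve \<open>h\<close> but only the constants, so that it serves two right-hand sides simultaneously.
\<close>

definition L :: real where "L = \<l> * W T / \<theta>"

lemma L_pos: "0 < L"
  using \<l>_pos W_pos[of T] \<theta> by (simp add: L_def)

lemma solution_set_nonempty: "solution_set T \<alpha> h L (L * T) \<noteq> {}"
proof -
  let ?I = "frac_integral \<alpha> picard_limit"
  let ?z = "restrict picard_limit {0..T}" and ?x = "restrict ?I {0..T}"
  have prim: "frac_primitive \<alpha> ?z t = ?I t" if "t \<in> {0..T}" for t
  proof -
    have "frac_integral \<alpha> ?z t = ?I t" by (rule frac_integral_cong) (use that in auto)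
    moreover have "?z 0 = 0" using T admissible_zero[OF picard_limit_admissible] by simp
    ultimately show ?thesis by (simp add: frac_primitive_def frac_integral_def)
  qed
  have I_mono: "norm (?I t - ?I s) \<le> L * (t - s)" if "0 \<le> s" "s \<le> t" "t \<le> T" for s t
  proof -
    have "norm (?I t - ?I s) \<le> \<l> * (t - s) * W t / \<theta>"
      by (rule frac_integral_admissible[OF picard_limit_admissible that])
    also have "\<dots> \<le> \<l> * (t - s) * W T / \<theta>"
      using that \<l>_pos \<theta> by (intro divide_right_mono mult_left_mono W_mono) auto
    finally show ?thesis by (simp add: L_def mult_ac)
  qed
  have lipI: "norm (?I t - ?I s) \<le> L * \<bar>t - s\<bar>" if "s \<in> {0..T}" "t \<in> {0..T}" for s t
    using I_mono[of s t] I_mono[of t s] that by (cases "s \<le> t") (auto simp: norm_minus_commute)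
  have "L-lipschitz_on {0..T} ?I"
    using lipI L_pos by (intro lipschitz_onI) (auto simp: dist_norm)
  then have contI: "continuous_on {0..T} ?I" by (rule lipschitz_on_continuous_on)
  have "norm (?I t) \<le> L * T" if t: "t \<in> {0..T}" for t
  proof -
    have "norm (?I t) \<le> L * t" using I_mono[of 0 t] t by (simp add: frac_integral_zero)
    also have "\<dots> \<le> L * T" using t L_pos by simp
    finally show ?thesis .
  qed
  then have "?x \<in> lip_funs T L (cball 0 (L * T))"
    using continuous_on_eq[OF contI, of ?x] lipI by (auto simp: lip_funs_def cont_funs_def)
  moreover have "solves_functional_eq T \<alpha> h ?z"
    using picard_limit_solves prim
      continuous_on_eq[OF admissible_continuous[OF picard_limit_admissible], of ?z]
    by (auto simp: solves_functional_eq_def cont_funs_def)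
  ultimately have "?x \<in> solution_set T \<alpha> h L (L * T)"
    using prim by (auto simp: solution_set_def intro!: exI[of _ ?z])
  then show ?thesis by blast
qed

end

section \<open>Comparison of the solution sets\<close>

text \<open>
  Since the members of a solution set are Lipschitz, the generating \<open>z\<close> vanishes at \<open>0\<close>; so the
  term \<open>z 0\<close> disappears from the equation.
\<close>

lemma solution_setE:
  fixes h :: "real \<Rightarrow> 'a::banach \<Rightarrow> 'a \<Rightarrow> 'a"
  assumes x: "x \<in> solution_set T \<alpha> h L R" and \<alpha>: "0 < \<alpha>" "\<alpha> < 1" and T: "0 < T"
  obtains z where "continuous_on {0..T} z"
    and "\<And>t. t \<in> {0..T} \<Longrightarrow> z t = h t (frac_integral \<alpha> z t) (z t)"
    and "\<And>t. t \<in> {0..T} \<Longrightarrow> x t = frac_integral \<alpha> z t"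
proof -
  from x obtain z where z: "continuous_on {0..T} z"
    and sol: "\<And>t. t \<in> {0..T} \<Longrightarrow> z t = h t (frac_primitive \<alpha> z t) (z t)"
    and xz: "\<And>t. t \<in> {0..T} \<Longrightarrow> x t = frac_primitive \<alpha> z t"
    and lipx: "\<And>s t. s \<in> {0..T} \<Longrightarrow> t \<in> {0..T} \<Longrightarrow> norm (x s - x t) \<le> L * \<bar>s - t\<bar>"
    by (auto simp: solution_set_def solves_functional_eq_def cont_funs_def lip_funs_def)
  have prim: "frac_primitive \<alpha> z t = z 0 + frac_integral \<alpha> z t" for t
    by (simp add: frac_primitive_def frac_integral_def)
  have "z 0 = 0"
  proof (rule frac_integral_lipschitz_imp_zero[OF \<alpha> T z])
    fix t assume t: "t \<in> {0..T}"
    have "frac_integral \<alpha> z 0 = 0" by (simp add: frac_integral_def)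
    then show "norm (frac_integral \<alpha> z t) \<le> L * t"
      using lipx[of t 0] xz[of t] xz[of 0] t T by (simp add: prim)
  qed
  then show thesis using that[of z] z sol xz by (simp add: prim)
qed

text \<open>
  The trajectory \<open>w\<close> generating \<open>y\<close> solves the equation for \<open>f\<close> up to the defect \<open>f - g\<close>, which is
  at most \<open>K W\<close>, and stability yields \<open>norm (z - w) \<le> K / (1 - q) * W\<close>. The remaining
  integration uses that \<open>W\<close> is increasing: on \<open>{0..t}\<close> it is replaced by the constant \<open>W t\<close>, which
  produces the factor \<open>T\<^sup>\<alpha> / \<Gamma>(\<alpha> + 1)\<close> instead of \<open>1 / \<theta>\<close>.
\<close>

lemma solution_sets_close:
  fixes f g :: "real \<Rightarrow> 'a::banach \<Rightarrow> 'a \<Rightarrow> 'a"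
  assumes "implicit_frac_equation \<alpha> \<theta> T M1 M2 M3 f" and K: "0 < K"
    and fg: "\<And>t x y. t \<in> {0..T} \<Longrightarrow> norm (f t x y - g t x y) \<le> K * mittag_leffler \<alpha> (\<theta> * t powr \<alpha>)"
    and x: "x \<in> solution_set T \<alpha> f L R" and y: "y \<in> solution_set T \<alpha> g L R"
  shows "bielecki_norm T \<alpha> \<theta> (\<lambda>t. x t - y t)
    \<le> K * T powr \<alpha> / (Gamma (\<alpha> + 1) * (1 - (M2 / \<theta> + M3)))"
proof -
  interpret implicit_frac_equation \<alpha> \<theta> T M1 M2 M3 f by fact
  obtain z where z: "continuous_on {0..T} z"
    and zf: "\<And>t. t \<in> {0..T} \<Longrightarrow> z t = f t (frac_integral \<alpha> z t) (z t)"
    and xz: "\<And>t. t \<in> {0..T} \<Longrightarrow> x t = frac_integral \<alpha> z t"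
    using solution_setE[OF x \<alpha> T] by blast
  obtain w where w: "continuous_on {0..T} w"
    and wg: "\<And>t. t \<in> {0..T} \<Longrightarrow> w t = g t (frac_integral \<alpha> w t) (w t)"
    and yw: "\<And>t. t \<in> {0..T} \<Longrightarrow> y t = frac_integral \<alpha> w t"
    using solution_setE[OF y \<alpha> T] by blast
  have close: "norm (z t - w t) \<le> K / (1 - q) * W t" if t: "t \<in> {0..T}" for t
  proof (rule stability[OF z w zf _ t])
    fix t assume t: "t \<in> {0..T}"
    show "norm (f t (frac_integral \<alpha> w t) (w t) - w t) \<le> K * W t"
      using fg[OF t, of "frac_integral \<alpha> w t" "w t"] wg[OF t] by (simp add: W_def)
  qed
  have c: "0 \<le> K / (1 - q)" using K q_lt_1 by simp
  have \<Gamma>: "0 < Gamma (\<alpha> + 1)" using \<alpha> by (simp add: Gamma_real_pos)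
  show ?thesis
    unfolding bielecki_norm_def
  proof (rule cSUP_least)
    fix t assume t: "t \<in> {0..T}"
    have "norm (x t - y t) = norm (frac_integral \<alpha> (\<lambda>s. z s - w s) t)"
      using t \<alpha> xz yw continuous_on_subset[OF z, of "{0..t}"] continuous_on_subset[OF w, of "{0..t}"]
      by (subst frac_integral_diff) auto
    also have "\<dots> \<le> (K / (1 - q) * W t) * t powr \<alpha> / Gamma (\<alpha> + 1)"
    proof (rule frac_integral_const_bound)
      show "norm (z s - w s) \<le> K / (1 - q) * W t" if s: "0 \<le> s" "s \<le> t" for s
        using order_trans[OF close mult_left_mono[OF W_mono[OF s] c]] s t by simp
    qed (use t \<alpha> in \<open>auto intro!: continuous_intros continuous_on_subset[OF z] continuous_on_subset[OF w]\<close>)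
    also have "\<dots> \<le> (K / (1 - q) * W t) * T powr \<alpha> / Gamma (\<alpha> + 1)"
      using t \<alpha> c \<Gamma> W_pos[of t] by (intro divide_right_mono mult_left_mono powr_mono2 mult_nonneg_nonneg) auto
    also have "\<dots> = K * T powr \<alpha> / (Gamma (\<alpha> + 1) * (1 - (M2 / \<theta> + M3))) * W t"
      by (simp add: q_def mult_ac)
    finally show "norm (x t - y t) / mittag_leffler \<alpha> (\<theta> * t powr \<alpha>)
        \<le> K * T powr \<alpha> / (Gamma (\<alpha> + 1) * (1 - (M2 / \<theta> + M3)))"
      using W_pos[of t] unfolding W_def[symmetric] by (simp only: pos_divide_le_eq)
  qed (use T in auto)
qed

lemma pompeiu_hausdorff_le:
  assumes "Y \<noteq> {}" and "Z \<noteq> {}" and le: "\<And>a b. a \<in> Y \<Longrightarrow> b \<in> Z \<Longrightarrow> d a b \<le> c"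
  shows "pompeiu_hausdorff d Y Z \<le> ennreal c"
proof -
  obtain a0 b0 where a0: "a0 \<in> Y" and b0: "b0 \<in> Z" using assms by blast
  have "(INF b\<in>Z. ennreal (d a b)) \<le> ennreal c" if "a \<in> Y" for a
    by (rule INF_lower2[OF b0]) (use le that b0 in \<open>auto intro: ennreal_leI\<close>)
  moreover have "(INF a\<in>Y. ennreal (d a b)) \<le> ennreal c" if "b \<in> Z" for b
    by (rule INF_lower2[OF a0]) (use le that a0 in \<open>auto intro: ennreal_leI\<close>)
  ultimately show ?thesis
    unfolding pompeiu_hausdorff_def by (auto intro!: SUP_least)
qed

theorem theorem3p5:
  fixes f g :: "real \<Rightarrow> 'a::banach \<Rightarrow> 'a \<Rightarrow> 'a"
    and T \<alpha> M1 M2 M3 \<theta> K :: real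
  assumes "T > 0" and "0 < \<alpha>" and "\<alpha> < 1"
    and "M1 > 0" and "M2 > 0" and "0 < M3" and "M3 < 1"
    and f_cont: "continuous_on ({0..T} \<times> UNIV \<times> UNIV) (\<lambda>(t, x, y). f t x y)"
    and g_cont: "continuous_on ({0..T} \<times> UNIV \<times> UNIV) (\<lambda>(t, x, y). g t x y)"
    and f_lip: "\<And>t1 t2 x1 x2 y1 y2. t1 \<in> {0..T} \<Longrightarrow> t2 \<in> {0..T} \<Longrightarrow>
      norm (f t1 x1 y1 - f t2 x2 y2) \<le> M1 * \<bar>t1 - t2\<bar> + M2 * norm (x1 - x2) + M3 * norm (y1 - y2)"
    and g_lip: "\<And>t1 t2 x1 x2 y1 y2. t1 \<in> {0..T} \<Longrightarrow> t2 \<in> {0..T} \<Longrightarrow>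
      norm (g t1 x1 y1 - g t2 x2 y2) \<le> M1 * \<bar>t1 - t2\<bar> + M2 * norm (x1 - x2) + M3 * norm (y1 - y2)"
    and f_init: "\<And>x. f 0 x x = x"
    and g_init: "\<And>x. g 0 x x = x"
    and "\<theta> > 0" and "M2 / \<theta> + M3 < 1"
    and "K > 0"
    and fg_close: "\<And>t x y. t \<in> {0..T} \<Longrightarrow>
      norm (f t x y - g t x y) \<le> K * mittag_leffler \<alpha> (\<theta> * t powr \<alpha>)"
  shows "\<exists>L R. L > 0 \<and> R > 0 \<and>
    solution_set T \<alpha> f L R \<noteq> {} \<and> solution_set T \<alpha> g L R \<noteq> {} \<and>
    pompeiu_hausdorff (\<lambda>x y. bielecki_norm T \<alpha> \<theta> (\<lambda>t. x t - y t))
        (solution_set T \<alpha> f L R) (solution_set T \<alpha> g L R)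
      \<le> ennreal (K * T powr \<alpha> / (Gamma (\<alpha> + 1) * (1 - (M2 / \<theta> + M3))))"
proof -
  have f_eq: "implicit_frac_equation \<alpha> \<theta> T M1 M2 M3 f"
    using assms by unfold_locales auto
  have g_eq: "implicit_frac_equation \<alpha> \<theta> T M1 M2 M3 g"
    using assms by unfold_locales auto
  interpret F: implicit_frac_equation \<alpha> \<theta> T M1 M2 M3 f by (rule f_eq)
  interpret G: implicit_frac_equation \<alpha> \<theta> T M1 M2 M3 g by (rule g_eq)
  have nonempty: "solution_set T \<alpha> f F.L (F.L * T) \<noteq> {}" "solution_set T \<alpha> g F.L (F.L * T) \<noteq> {}"
    by (rule F.solution_set_nonempty, rule G.solution_set_nonempty)
  show ?thesis
  proof (rule exI[of _ F.L], rule exI[of _ "F.L * T"], intro conjI)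
    show "pompeiu_hausdorff (\<lambda>x y. bielecki_norm T \<alpha> \<theta> (\<lambda>t. x t - y t))
        (solution_set T \<alpha> f F.L (F.L * T)) (solution_set T \<alpha> g F.L (F.L * T))
      \<le> ennreal (K * T powr \<alpha> / (Gamma (\<alpha> + 1) * (1 - (M2 / \<theta> + M3))))"
      by (rule pompeiu_hausdorff_le[OF nonempty solution_sets_close[OF f_eq \<open>K > 0\<close> fg_close]])
  qed (use F.L_pos \<open>T > 0\<close> nonempty in auto)
qed

end
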